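(* Let $0<k<n$, $l=n-k$, and let $(\Gamma,\alpha)$ be the one-skeleton (Johnson graph) of the Grassmannian $Gr^k(\mathbb C^n)$, with $\xi=(1,2,\dots,n)$. For each vertex $p$ let $\tau_p$ be the unique class in $H^{2\,\mathrm{index}(p)}(\Gamma,\alpha)$ supported on $F_p$ with $\tau_p(p)=\prod_{e\in E_p,\ \alpha_e(\xi)<0}\alpha_e$. Let $p_0=p_{S_0}$ with $S_0=\{l+1,\dots,n\}$, let $p$ be a vertex of index $r$, put $s=kl-r$, and let $\sigma_{i_1},\dots,\sigma_{i_s}$ be elementary reflections such that $p_0=\sigma_{i_s}\circ\cdots\circ\sigma_{i_1}(p)$ and such that $\phi$ is strictly increasing along the sequence of vertices $p,\ \sigma_{i_1}(p),\ \sigma_{i_2}\sigma_{i_1}(p),\ \dots,\ \sigma_{i_s}\cdots\sigma_{i_1}(p)=p_0$. Then $$\tau_p=D_{\sigma_{i_1}}\circ\cdots\circ D_{\sigma_{i_s}}(\tau_{p_0}).$$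
   Context: $\mathfrak g=\mathbb R^n$, $\alpha_i\in\mathfrak g^*$ is the $i$-th coordinate function, $\mathbb S(\mathfrak g^* )=\bigoplus_m\mathbb S^m(\mathfrak g^* )$ the polynomial ring in $\alpha_1,\dots,\alpha_n$. Johnson graph: the vertices $p_S$ of $\Gamma$ correspond to the $k$-element subsets $S$ of $\{1,\dots,n\}$; $p_S$ and $p_{S'}$ are adjacent iff $\#(S\cap S')=k-1$; the oriented edge $e$ from $p_S$ to $p_{S'}$ has $\alpha_e=\alpha_j-\alpha_i$ where $\{i\}=S-S'$, $\{j\}=S'-S$. $E_p$ is the set of oriented edges with initial vertex $p$. The index of $p$ is the number of $e\in E_p$ with $\alpha_e(\xi)<0$, and $\phi(p_S)=\sum_{i\in S}i$. $F_p$ is the set of vertices (including $p$) reachable from $p$ by a path of adjacent vertices along which $\phi$ is strictly increasing. $H(\Gamma,\alpha)$ is the ring of maps $f:V_\Gamma\to\mathbb S(\mathfrak g^* )$ with $f(p)-f(q)\in\alpha_e\mathbb S(\mathfrak g^* )$ for every edge $e$ joining $p,q$; $H^{2m}(\Gamma,\alpha)$ consists of those $f$ with values in $\mathbb S^m(\mathfrak g^* )$. $\sigma_i$ ($1\le i\le n-1$) is the elementary reflection interchanging $i$ and $i+1$; it acts on vertices by $\sigma_i(p_S)=p_{\sigma_i(S)}$ and on $\mathbb S(\mathfrak g^* )$ by the ring automorphism interchanging $\alpha_i$ and $\alpha_{i+1}$. The divided difference operator $D_{\sigma_i}:H(\Gamma,\alpha)\to H(\Gamma,\alpha)$ is $$(D_{\sigma_i}f)(p)=\frac{f(p)-\sigma_i\big(f(\sigma_i^{-1}p)\big)}{\alpha_i-\alpha_{i+1}}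 .$$ *)

theory Defs
  imports
    Complex_Main
    "HOL-Library.Poly_Mapping"
    "HOL-Library.FuncSet"
    "HOL-Combinatorics.Transposition"
begin

section \<open>The polynomial ring\<close>

text \<open>
  Real polynomials in countably many variables \<open>\<alpha>\<^sub>0, \<alpha>\<^sub>1, \<dots>\<close>, as finitely supported coefficient
  functions on monomials. The ring \<open>\<S>(\<gg>\<^sup>*)\<close> for \<open>\<gg> = \<real>\<^sup>n\<close> is the subring
  \<open>poly_ring n\<close> of polynomials that involve only \<open>\<alpha>\<^sub>1, \<dots>, \<alpha>\<^sub>n\<close>.
\<close>

type_synonym rpoly = "(nat \<Rightarrow>\<^sub>0 nat) \<Rightarrow>\<^sub>0 real"

definition const :: "real \<Rightarrow> rpoly" where
  "const c = Poly_Mapping.single 0 c"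

definition coord :: "nat \<Rightarrow> rpoly" where
  "coord i = Poly_Mapping.single (Poly_Mapping.single i 1) 1"

definition poly_ring :: "nat \<Rightarrow> rpoly set" where
  "poly_ring n = {f. \<forall>m \<in> Poly_Mapping.keys f. Poly_Mapping.keys m \<subseteq> {1..n}}"

definition poly_ring_deg :: "nat \<Rightarrow> nat \<Rightarrow> rpoly set" where
  "poly_ring_deg n d = {f \<in> poly_ring n. \<forall>m \<in> Poly_Mapping.keys f. (\<Sum>i \<in> Poly_Mapping.keys m. Poly_Mapping.lookup m i) = d}"

text \<open>Substitution of \<open>x i\<close> for \<open>\<alpha>\<^sub>i\<close>, with the coefficients sent to the target ring by \<open>h\<close>.\<close>

definition subst_poly :: "(real \<Rightarrow> 'b) \<Rightarrow> (nat \<Rightarrow> 'b) \<Rightarrow> rpoly \<Rightarrow> 'b::comm_semiring_1" where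
  "subst_poly h x f = (\<Sum>m \<in> Poly_Mapping.keys f. h (Poly_Mapping.lookup f m) * (\<Prod>i \<in> Poly_Mapping.keys m. x i ^ Poly_Mapping.lookup m i))"

definition eval_at :: "(nat \<Rightarrow> real) \<Rightarrow> rpoly \<Rightarrow> real" where
  "eval_at x = subst_poly (\<lambda>c. c) x"

definition xi :: "nat \<Rightarrow> real" where
  "xi i = real i"

text \<open>The exact quotient in \<open>poly_ring n\<close>; it is unique for \<open>b \<noteq> 0\<close> because \<^typ>\<open>rpoly\<close>
  is an integral domain.\<close>

definition exact_quot :: "nat \<Rightarrow> rpoly \<Rightarrow> rpoly \<Rightarrow> rpoly" where
  "exact_quot n a b = (THE g. g \<in> poly_ring n \<and> b * g = a)"

lemma exact_quot_eqI:
  assumes "g \<in> poly_ring n" "b * g = a" "b \<noteq> 0"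
  shows "exact_quot n a b = g"
  unfolding exact_quot_def using assms by (intro the_equality) auto

section \<open>The Johnson graph as a one-skeleton\<close>

text \<open>The vertex \<open>p\<^sub>S\<close> is represented by the set \<open>S\<close> itself.\<close>

definition vertices :: "nat \<Rightarrow> nat \<Rightarrow> nat set set" where
  "vertices n k = {S. S \<subseteq> {1..n} \<and> card S = k}"

definition edges :: "nat \<Rightarrow> nat \<Rightarrow> (nat set \<times> nat set) set" where
  "edges n k = {(S, T). S \<in> vertices n k \<and> T \<in> vertices n k \<and> card (S \<inter> T) = k - 1}"

definition edges_from :: "nat \<Rightarrow> nat \<Rightarrow> nat set \<Rightarrow> (nat set \<times> nat set) set" where
  "edges_from n k p = {e \<in> edges n k. fst e = p}"

definition axial :: "nat set \<times> nat set \<Rightarrow> rpoly" where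
  "axial e = coord (the_elem (snd e - fst e)) - coord (the_elem (fst e - snd e))"

definition down_edges :: "nat \<Rightarrow> nat \<Rightarrow> nat set \<Rightarrow> (nat set \<times> nat set) set" where
  "down_edges n k p = {e \<in> edges_from n k p. eval_at xi (axial e) < 0}"

definition index :: "nat \<Rightarrow> nat \<Rightarrow> nat set \<Rightarrow> nat" where
  "index n k p = card (down_edges n k p)"

definition phi :: "nat set \<Rightarrow> nat" where
  "phi S = (\<Sum>i \<in> S. i)"

definition flow_up :: "nat \<Rightarrow> nat \<Rightarrow> nat set \<Rightarrow> nat set set" where
  "flow_up n k p = {q \<in> vertices n k. (p, q) \<in> {(a, b) \<in> edges n k. phi a < phi b}\<^sup>*}"

section \<open>The cohomology ring and its Thom classes\<close>

text \<open>Maps on the vertex set are extensional (\<^term>\<open>undefined\<close> off \<^term>\<open>vertices n k\<close>),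
  so that equality in HOL is equality of maps on the vertices.\<close>

definition cohom :: "nat \<Rightarrow> nat \<Rightarrow> (nat set \<Rightarrow> rpoly) set" where
  "cohom n k = {f \<in> vertices n k \<rightarrow>\<^sub>E poly_ring n.
     \<forall>(p, q) \<in> edges n k. \<exists>g \<in> poly_ring n. f p - f q = axial (p, q) * g}"

text \<open>\<open>cohom_even n k m\<close> is \<open>H\<^sup>2\<^sup>m(\<Gamma>, \<alpha>)\<close>: the polynomial degree is \<open>m\<close>.\<close>

definition cohom_even :: "nat \<Rightarrow> nat \<Rightarrow> nat \<Rightarrow> (nat set \<Rightarrow> rpoly) set" where
  "cohom_even n k m = {f \<in> cohom n k. \<forall>p \<in> vertices n k. f p \<in> poly_ring_deg n m}"

definition is_thom_class :: "nat \<Rightarrow> nat \<Rightarrow> nat set \<Rightarrow> (nat set \<Rightarrow> rpoly) \<Rightarrow> bool" where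
  "is_thom_class n k p f \<longleftrightarrow>
     f \<in> cohom_even n k (index n k p) \<and>
     (\<forall>q \<in> vertices n k. f q \<noteq> 0 \<longrightarrow> q \<in> flow_up n k p) \<and>
     f p = (\<Prod>e \<in> down_edges n k p. axial e)"

definition thom_class :: "nat \<Rightarrow> nat \<Rightarrow> nat set \<Rightarrow> (nat set \<Rightarrow> rpoly)" where
  "thom_class n k p = (THE f. is_thom_class n k p f)"

section \<open>Divided difference operators\<close>

definition elem_refl :: "nat \<Rightarrow> nat \<Rightarrow> nat" where
  "elem_refl i = Transposition.transpose i (i + 1)"

definition refl_vertex :: "nat \<Rightarrow> nat set \<Rightarrow> nat set" where
  "refl_vertex i S = elem_refl i ` S"

definition refl_poly :: "nat \<Rightarrow> rpoly \<Rightarrow> rpoly" where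
  "refl_poly i = subst_poly const (\<lambda>j. coord (elem_refl i j))"

definition div_diff :: "nat \<Rightarrow> nat \<Rightarrow> nat \<Rightarrow> (nat set \<Rightarrow> rpoly) \<Rightarrow> (nat set \<Rightarrow> rpoly)" where
  "div_diff n k i f = (\<lambda>p \<in> vertices n k.
     exact_quot n (f p - refl_poly i (f (inv (elem_refl i) ` p))) (coord i - coord (i + 1)))"

end

(*
  A Thom class at p is determined by its conditions: at a phi-minimal vertex q of the support of the
  difference of two of them, the difference is divisible by the pairwise coprime linear forms
  alpha_e of all downward edges at q, and their number index(q) > index(p) exceeds its degree.
  A reflection sigma_i that raises phi raises it, and hence the index, by exactly one. Then
  D_{sigma_i} carries a Thom class at sigma_i(p) to one at p: the value at p follows because sigma_i
  maps the downward pairs of p bijectively onto those of sigma_i(p) other than (i + 1, i), and the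
  support condition is the lifting property of the Bruhat order. Starting from the class at the
  top vertex p_0, which is supported at p_0 alone, the word of reflections yields tau_p.
*)
theory Submission
  imports Defs "HOL-Computational_Algebra.Polynomial"
begin

section \<open>Substitution homomorphisms\<close>

lemma update_eq_plus_single:
  assumes "a \<notin> Poly_Mapping.keys f"
  shows "Poly_Mapping.update a b f = f + Poly_Mapping.single a b"
  using assms
  by (intro poly_mapping_eqI) (auto simp: lookup_update lookup_add lookup_single when_def in_keys_iff)

text \<open>Serves both polynomials, built term by term, and exponent vectors, built one variable at
  a time: both are finitely supported functions.\<close>

lemma poly_mapping_single_induct [case_names zero add]:
  fixes f :: "'a \<Rightarrow>\<^sub>0 'b::comm_monoid_add"
  assumes "P 0" "\<And>f a b. P f \<Longrightarrow> P (f + Poly_Mapping.single a b)"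
  shows "P f"
proof (induction f rule: update_induct)
  case const
  show ?case by (rule assms(1))
next
  case (update f a b)
  then show ?case using assms(2) by (simp add: update_eq_plus_single)
qed

lemma coord_power: "coord i ^ e = Poly_Mapping.single (Poly_Mapping.single i e) 1"
  by (induction e) (simp_all add: coord_def mult_single flip: single_add)

text \<open>A term is a constant times powers of coordinates, so these generate the ring and facts
  about ring homomorphisms need checking on them only.\<close>

lemma rpoly_induct [case_names const coord add mult]:
  assumes const: "\<And>c. P (const c)" and coord: "\<And>i. P (coord i)"
    and add: "\<And>f g. P f \<Longrightarrow> P g \<Longrightarrow> P (f + g)" and mult: "\<And>f g. P f \<Longrightarrow> P g \<Longrightarrow> P (f * g)"
  shows "P f"
proof -
  have pow: "P (coord i ^ e)" for i e
  proof (induction e)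
    case 0
    show ?case using const[of 1] by (simp add: const_def)
  qed (simp add: mult coord)
  have single: "P (Poly_Mapping.single m a)" for m a
  proof (induction m rule: poly_mapping_single_induct)
    case zero
    show ?case using const[of a] by (simp add: const_def)
  next
    case (add m i e)
    have "Poly_Mapping.single (m + Poly_Mapping.single i e) a = Poly_Mapping.single m a * coord i ^ e"
      by (simp add: coord_power mult_single)
    then show ?case using mult add pow by simp
  qed
  show ?thesis
  proof (induction f rule: poly_mapping_single_induct)
    case zero
    show ?case using const[of 0] by (simp add: const_def)
  qed (simp add: add single)
qed

text \<open>Covers three coefficient maps: into the reals for evaluation, into \<open>rpoly\<close>
  for substitution, and into univariate polynomials over \<open>rpoly\<close> for the
  grading.\<close>

locale coeff_hom =
  fixes h :: "real \<Rightarrow> 'b::comm_ring_1"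
  assumes h_0: "h 0 = 0" and h_1: "h 1 = 1"
    and h_add: "h (a + b) = h a + h b" and h_mult: "h (a * b) = h a * h b"
begin

lemma subst_add: "subst_poly h x (f + g) = subst_poly h x f + subst_poly h x g"
  unfolding subst_poly_def
  by (rule setsum_keys_plus_distrib) (simp_all add: h_0 h_add algebra_simps)

lemma subst_single:
  "subst_poly h x (Poly_Mapping.single m a)
    = h a * (\<Prod>i \<in> Poly_Mapping.keys m. x i ^ Poly_Mapping.lookup m i)"
  by (simp add: subst_poly_def h_0)

lemma subst_const [simp]: "subst_poly h x (const c) = h c"
  by (simp add: const_def subst_single)

lemma subst_coord [simp]: "subst_poly h x (coord i) = x i"
  by (simp add: coord_def subst_single h_1)

lemma subst_0 [simp]: "subst_poly h x 0 = 0"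
  by (simp add: subst_poly_def)

lemma subst_1 [simp]: "subst_poly h x 1 = 1"
  using subst_const[of x 1] by (simp add: const_def h_1)

lemma monomial_plus:
  "(\<Prod>i \<in> Poly_Mapping.keys (m + m'). x i ^ Poly_Mapping.lookup (m + m') i)
    = (\<Prod>i \<in> Poly_Mapping.keys m. x i ^ Poly_Mapping.lookup m i)
    * (\<Prod>i \<in> Poly_Mapping.keys m'. x i ^ Poly_Mapping.lookup m' i)"
  for m m' :: "nat \<Rightarrow>\<^sub>0 nat" and x :: "nat \<Rightarrow> 'b"
proof -
  let ?K = "Poly_Mapping.keys m \<union> Poly_Mapping.keys m'"
  \<comment> \<open>Passing to the larger index set \<open>?K\<close> adds only factors with
    exponent zero.\<close>
  have ext: "(\<Prod>i \<in> Poly_Mapping.keys u. x i ^ Poly_Mapping.lookup u i)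
      = (\<Prod>i \<in> ?K. x i ^ Poly_Mapping.lookup u i)"
    if "Poly_Mapping.keys u \<subseteq> ?K" for u
    using that by (intro prod.mono_neutral_left) (auto simp: in_keys_iff)
  have "(\<Prod>i \<in> Poly_Mapping.keys (m + m'). x i ^ Poly_Mapping.lookup (m + m') i)
      = (\<Prod>i \<in> ?K. x i ^ Poly_Mapping.lookup m i * x i ^ Poly_Mapping.lookup m' i)"
    using keys_add[of m m'] by (subst ext) (simp_all add: lookup_add power_add)
  then show ?thesis
    by (simp only: prod.distrib ext[OF Un_upper1] ext[OF Un_upper2])
qed

text \<open>Both sides are additive in each factor, which leaves products of two single
  terms.\<close>

lemma subst_mult: "subst_poly h x (f * g) = subst_poly h x f * subst_poly h x g"
proof (induction f rule: poly_mapping_single_induct)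
  case (add f m a)
  have "subst_poly h x (Poly_Mapping.single m a * g)
      = subst_poly h x (Poly_Mapping.single m a) * subst_poly h x g"
  proof (induction g rule: poly_mapping_single_induct)
    case (add g m' b)
    have "subst_poly h x (Poly_Mapping.single m a * Poly_Mapping.single m' b)
        = subst_poly h x (Poly_Mapping.single m a) * subst_poly h x (Poly_Mapping.single m' b)"
      unfolding mult_single subst_single h_mult monomial_plus by (simp only: ac_simps)
    with add show ?case by (simp add: subst_add distrib_left)
  qed simp
  with add show ?case by (simp add: subst_add distrib_right)
qed simp

lemma subst_diff: "subst_poly h x (f - g) = subst_poly h x f - subst_poly h x g"
  using subst_add[of x "f - g" g] by simp

lemma subst_uminus: "subst_poly h x (- f) = - subst_poly h x f"
  using subst_diff[of x 0 f] by simp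

lemma subst_prod: "subst_poly h x (\<Prod>i\<in>I. f i) = (\<Prod>i\<in>I. subst_poly h x (f i))"
  by (induction I rule: infinite_finite_induct) (simp_all add: subst_mult)

lemmas subst_simps = subst_add subst_mult subst_diff subst_uminus subst_prod

end

interpretation real: coeff_hom "\<lambda>c::real. c"
  by unfold_locales simp_all

interpretation const: coeff_hom const
  by unfold_locales (simp_all add: const_def single_add mult_single)

interpretation const_poly: coeff_hom "\<lambda>c. [:const c:]"
  by unfold_locales (simp_all add: const.h_0 const.h_1 const.h_add const.h_mult one_pCons)

lemma subst_const_coord: "subst_poly const coord f = f"
  by (induction f rule: rpoly_induct) (simp_all add: const.subst_simps)

text \<open>Modulo \<open>d\<close> the substitution is the identity on the generators, hence on the
  whole ring.\<close>

lemma dvd_diff_subst_poly: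
  assumes "\<And>j. d dvd coord j - x j"
  shows "d dvd f - subst_poly const x f"
proof (induction f rule: rpoly_induct)
  case (mult f g)
  have "f * g - subst_poly const x f * subst_poly const x g
      = (f - subst_poly const x f) * g + subst_poly const x f * (g - subst_poly const x g)"
    by (simp add: algebra_simps)
  with mult show ?case by (simp add: const.subst_simps)
next
  case (add f g)
  have "f + g - (subst_poly const x f + subst_poly const x g)
      = (f - subst_poly const x f) + (g - subst_poly const x g)"
    by (simp add: algebra_simps)
  with add show ?case by (simp only: const.subst_simps dvd_add)
qed (simp_all add: assms)

section \<open>Divisibility by differences of coordinates\<close>

lemma coord_eq_iff: "coord i = coord j \<longleftrightarrow> i = j"
proof
  assume "coord i = coord j"
  then have "eval_at real (coord i) = eval_at real (coord j)" by simp
  then show "i = j" by (simp add: eval_at_def)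
qed simp

text \<open>A model of the quotient map modulo \<open>coord b - coord a\<close> with values in the
  same integral domain: primality of this linear form becomes the absence of zero divisors.\<close>

definition merge :: "nat \<Rightarrow> nat \<Rightarrow> rpoly \<Rightarrow> rpoly" where
  "merge a b = subst_poly const (\<lambda>j. if j = b then coord a else coord j)"

lemma merge_coord: "merge a b (coord j) = (if j = b then coord a else coord j)"
  by (simp add: merge_def)

lemmas merge_hom = const.subst_simps[of "\<lambda>j. if j = b then coord a else coord j" for a b, folded merge_def]

text \<open>\<open>merge a b\<close> kills the linear form and moves every polynomial by a multiple
  of it.\<close>

lemma coord_diff_dvd_iff: "coord b - coord a dvd f \<longleftrightarrow> merge a b f = 0"
proof
  assume "coord b - coord a dvd f"
  then show "merge a b f = 0" by (auto elim!: dvdE simp: merge_hom merge_coord)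
next
  have "coord b - coord a dvd f - merge a b f"
    unfolding merge_def by (rule dvd_diff_subst_poly) simp
  then show "coord b - coord a dvd f" if "merge a b f = 0" using that by simp
qed

lemma merge_coord_diff_eq_0_iff:
  assumes "a \<noteq> b"
  shows "merge a b (coord d - coord c) = 0 \<longleftrightarrow> c = d \<or> {a, b} = {c, d}"
  using assms by (auto simp: merge_hom merge_coord coord_eq_iff doubleton_eq_iff)

text \<open>The linear forms are pairwise coprime: by the orientation \<open>b < a\<close>, distinct
  pairs differ as unordered pairs, so merging the variables of one pair kills no other
  factor.\<close>

lemma prod_coord_diff_dvd:
  assumes "finite I" and "\<And>a b. (a, b) \<in> I \<Longrightarrow> b < a" and "\<And>a b. (a, b) \<in> I \<Longrightarrow> coord b - coord a dvd f"
  shows "(\<Prod>(a, b)\<in>I. coord b - coord a) dvd f"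
  using assms
proof (induction I rule: finite_induct)
  case (insert c I)
  obtain a b where c: "c = (a, b)" by force
  have "(\<Prod>(a, b)\<in>I. coord b - coord a) dvd f"
    using insert by simp
  then obtain g where g: "f = (\<Prod>(a, b)\<in>I. coord b - coord a) * g" by (elim dvdE)
  \<comment> \<open>The factors already split off survive \<open>merge a b\<close>, so the vanishing
    of \<open>f\<close> under it passes to the cofactor \<open>g\<close>.\<close>
  have "merge a b (\<Prod>(a, b)\<in>I. coord b - coord a) \<noteq> 0"
  proof
    assume "merge a b (\<Prod>(a, b)\<in>I. coord b - coord a) = 0"
    then obtain a' b' where ab': "(a', b') \<in> I" "merge a b (coord b' - coord a') = 0"
      using insert(1) by (auto simp: merge_hom)
    moreover have "b < a" "b' < a'" using insert.prems(1) c ab' by auto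
    ultimately have "(a', b') = (a, b)"
      by (auto simp: merge_coord_diff_eq_0_iff doubleton_eq_iff)
    then show False using ab' insert.hyps c by simp
  qed
  moreover have "merge a b f = 0"
    using insert.prems(2) c by (simp flip: coord_diff_dvd_iff)
  ultimately have "merge a b g = 0" using g by (simp add: merge_hom)
  then have "coord b - coord a dvd g" by (simp add: coord_diff_dvd_iff)
  then show ?case using insert.hyps c g by (simp add: mult.commute mult_dvd_mono)
qed simp

section \<open>The subring in \<open>n\<close> variables and its grading\<close>

lemma poly_ring_add: "f \<in> poly_ring n \<Longrightarrow> g \<in> poly_ring n \<Longrightarrow> f + g \<in> poly_ring n"
  using keys_add[of f g] by (auto simp: poly_ring_def)

lemma poly_ring_mult: "f \<in> poly_ring n \<Longrightarrow> g \<in> poly_ring n \<Longrightarrow> f * g \<in> poly_ring n"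
proof -
  assume *: "f \<in> poly_ring n" "g \<in> poly_ring n"
  have "Poly_Mapping.keys m \<subseteq> {1..n}" if m: "m \<in> Poly_Mapping.keys (f * g)" for m
  proof -
    obtain a b where ab: "m = a + b" "a \<in> Poly_Mapping.keys f" "b \<in> Poly_Mapping.keys g"
      using m keys_mult[of f g] by blast
    then have "Poly_Mapping.keys a \<subseteq> {1..n}" "Poly_Mapping.keys b \<subseteq> {1..n}"
      using * by (simp_all add: poly_ring_def)
    with keys_add[of a b] ab(1) show ?thesis by blast
  qed
  then show ?thesis by (simp add: poly_ring_def)
qed

lemma const_in_poly_ring: "const c \<in> poly_ring n"
  by (simp add: const_def poly_ring_def)

lemma coord_in_poly_ring: "i \<in> {1..n} \<Longrightarrow> coord i \<in> poly_ring n"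
  by (simp add: coord_def poly_ring_def)

lemma poly_ring_0: "0 \<in> poly_ring n"
  by (simp add: poly_ring_def)

lemma poly_ring_1: "1 \<in> poly_ring n"
  by (simp add: poly_ring_def)

lemma poly_ring_diff: "f \<in> poly_ring n \<Longrightarrow> g \<in> poly_ring n \<Longrightarrow> f - g \<in> poly_ring n"
proof -
  assume "f \<in> poly_ring n" "g \<in> poly_ring n"
  then have "f + const (- 1) * g \<in> poly_ring n"
    by (intro poly_ring_add poly_ring_mult const_in_poly_ring)
  then show ?thesis by (simp add: const_def single_uminus)
qed

lemma poly_ring_prod: "(\<And>i. i \<in> I \<Longrightarrow> f i \<in> poly_ring n) \<Longrightarrow> (\<Prod>i\<in>I. f i) \<in> poly_ring n"
  by (induction I rule: infinite_finite_induct) (simp_all add: poly_ring_1 poly_ring_mult)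

text \<open>A retraction of the whole ring onto \<open>poly_ring n\<close>: membership becomes being
  a fixed point of a ring homomorphism.\<close>

definition restrict_vars :: "nat \<Rightarrow> rpoly \<Rightarrow> rpoly" where
  "restrict_vars n = subst_poly const (\<lambda>j. if j \<in> {1..n} then coord j else 0)"

lemmas restrict_vars_hom =
  const.subst_simps[of "\<lambda>j. if j \<in> {1..n} then coord j else 0" for n, folded restrict_vars_def]

lemma subst_poly_in_poly_ring:
  "(\<And>j. x j \<in> poly_ring n) \<Longrightarrow> subst_poly const x f \<in> poly_ring n"
  by (induction f rule: rpoly_induct)
    (simp_all add: const.subst_simps const_in_poly_ring poly_ring_add poly_ring_mult)

lemma subst_poly_cong:
  assumes "f \<in> poly_ring n" "\<And>j. j \<in> {1..n} \<Longrightarrow> x j = y j"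
  shows "subst_poly h x f = subst_poly h y f"
proof -
  have "(\<Prod>i \<in> Poly_Mapping.keys m. x i ^ Poly_Mapping.lookup m i)
      = (\<Prod>i \<in> Poly_Mapping.keys m. y i ^ Poly_Mapping.lookup m i)" if "m \<in> Poly_Mapping.keys f" for m
  proof (rule prod.cong)
    fix i assume "i \<in> Poly_Mapping.keys m"
    with that assms(1) have "i \<in> {1..n}" unfolding poly_ring_def by blast
    then show "x i ^ Poly_Mapping.lookup m i = y i ^ Poly_Mapping.lookup m i"
      using assms(2) by simp
  qed simp
  then show ?thesis by (simp add: subst_poly_def)
qed

lemma poly_ring_iff_restrict_vars: "f \<in> poly_ring n \<longleftrightarrow> restrict_vars n f = f"
proof
  assume "f \<in> poly_ring n"
  then have "restrict_vars n f = subst_poly const coord f"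
    unfolding restrict_vars_def by (rule subst_poly_cong) simp
  then show "restrict_vars n f = f" by (simp add: subst_const_coord)
next
  have "restrict_vars n f \<in> poly_ring n"
    unfolding restrict_vars_def
    by (rule subst_poly_in_poly_ring) (simp add: coord_in_poly_ring poly_ring_0)
  then show "f \<in> poly_ring n" if "restrict_vars n f = f" using that by simp
qed

text \<open>The retraction fixes \<open>b\<close> and \<open>b * g\<close>, hence also
  \<open>g\<close> after cancelling \<open>b\<close>.\<close>

lemma poly_ring_cancel:
  assumes "b * g \<in> poly_ring n" "b \<in> poly_ring n" "b \<noteq> 0"
  shows "g \<in> poly_ring n"
  using assms by (simp add: poly_ring_iff_restrict_vars restrict_vars_hom)

text \<open>The homogeneous components of a polynomial become the coefficients of a univariate one, so that
  degree considerations reduce to comparing coefficients.\<close>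

definition grading :: "rpoly \<Rightarrow> rpoly poly" where
  "grading = subst_poly (\<lambda>c. [:const c:]) (\<lambda>i. monom (coord i) 1)"

lemmas grading_hom = const_poly.subst_simps[of "\<lambda>i. monom (coord i) 1", folded grading_def]

lemma grading_coord: "grading (coord i) = monom (coord i) 1"
  by (simp add: grading_def)

lemma monom_prod: "(\<Prod>i\<in>I. monom (c i) (d i)) = monom (\<Prod>i\<in>I. c i) (\<Sum>i\<in>I. d i)"
  by (induction I rule: infinite_finite_induct) (simp_all add: mult_monom)

lemma sum_monom: "(\<Sum>i\<in>I. monom (c i) d) = monom (\<Sum>i\<in>I. c i) d"
  by (induction I rule: infinite_finite_induct) (simp_all add: add_monom)

lemma sum_singles: "(\<Sum>m\<in>Poly_Mapping.keys f. Poly_Mapping.single m (Poly_Mapping.lookup f m)) = f"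
  by (rule poly_mapping_eqI) (simp add: lookup_sum lookup_single when_def in_keys_iff)

lemma single_eq_prod:
  "Poly_Mapping.single m c = const c * (\<Prod>i \<in> Poly_Mapping.keys m. coord i ^ Poly_Mapping.lookup m i)"
  using subst_const_coord[of "Poly_Mapping.single m c"] by (simp add: const.subst_single)

lemma grading_eq_sum:
  "grading f = (\<Sum>m\<in>Poly_Mapping.keys f. monom (Poly_Mapping.single m (Poly_Mapping.lookup f m))
      (\<Sum>i\<in>Poly_Mapping.keys m. Poly_Mapping.lookup m i))"
  unfolding grading_def subst_poly_def
  by (intro sum.cong) (simp_all add: monom_power monom_prod smult_monom flip: single_eq_prod)

text \<open>Homogeneity as a single equation, which goes well with products because
  \<open>grading\<close> is a ring homomorphism.\<close>

lemma poly_ring_deg_iff: "f \<in> poly_ring_deg n d \<longleftrightarrow> f \<in> poly_ring n \<and> grading f = monom f d"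
proof safe
  assume f: "f \<in> poly_ring_deg n d"
  show "f \<in> poly_ring n" using f by (simp add: poly_ring_deg_def)
  have "grading f = (\<Sum>m\<in>Poly_Mapping.keys f. monom (Poly_Mapping.single m (Poly_Mapping.lookup f m)) d)"
    unfolding grading_eq_sum using f by (intro sum.cong) (simp_all add: poly_ring_deg_def)
  then show "grading f = monom f d" by (simp add: sum_monom sum_singles)
next
  assume f: "f \<in> poly_ring n" "grading f = monom f d"
  have "(\<Sum>i\<in>Poly_Mapping.keys m. Poly_Mapping.lookup m i) = d" if m: "m \<in> Poly_Mapping.keys f" for m
  proof (rule ccontr)
    let ?d = "\<lambda>m. \<Sum>i\<in>Poly_Mapping.keys m. Poly_Mapping.lookup m i"
    assume *: "?d m \<noteq> d"
    \<comment> \<open>A monomial of another degree would survive in the coefficient of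
      \<open>grading f\<close> at that degree, where \<open>monom f d\<close> has coefficient
      zero.\<close>
    have "Poly_Mapping.lookup (coeff (grading f) (?d m)) m
        = (\<Sum>m'\<in>Poly_Mapping.keys f. if m' = m then Poly_Mapping.lookup f m else 0)"
      unfolding grading_eq_sum coeff_sum lookup_sum
      by (intro sum.cong) (auto simp: lookup_single when_def)
    also have "\<dots> \<noteq> 0" using m by (simp add: in_keys_iff)
    finally show False using f(2) * by simp
  qed
  with f(1) show "f \<in> poly_ring_deg n d" by (simp add: poly_ring_deg_def)
qed

lemma grading_prod_coord_diff:
  "grading (\<Prod>(a, b)\<in>I. coord b - coord a) = monom (\<Prod>(a, b)\<in>I. coord b - coord a) (card I)"
  by (simp add: grading_hom case_prod_unfold grading_coord diff_monom monom_prod)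

text \<open>A multiple of a form of degree \<open>e\<close> has no component in the smaller degree
  \<open>d\<close>.\<close>

lemma poly_ring_deg_eq_0:
  assumes "f \<in> poly_ring_deg n d" "p * g = f" "grading p = monom p e" "d < e"
  shows "f = 0"
proof -
  have "monom f d = monom p e * grading g"
    using assms by (auto simp: poly_ring_deg_iff grading_hom)
  then have "coeff (monom f d) d = coeff (monom p e * grading g) d" by simp
  also have "\<dots> = 0" using \<open>d < e\<close> by (simp add: coeff_monom_mult)
  finally show ?thesis by simp
qed

text \<open>Comparing gradings, the nonzero factor \<open>monom p 1\<close> can be
  cancelled.\<close>

lemma poly_ring_deg_quot:
  assumes "p * g \<in> poly_ring_deg n (Suc d)" "p \<in> poly_ring_deg n 1" "p \<noteq> 0"
  shows "g \<in> poly_ring_deg n d"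
proof -
  have g: "g \<in> poly_ring n" using assms poly_ring_cancel[of p g n] by (simp add: poly_ring_deg_iff)
  have "monom p 1 * grading g = monom p 1 * monom g d"
    using assms by (simp add: poly_ring_deg_iff grading_hom mult_monom)
  then have "grading g = monom g d" using \<open>p \<noteq> 0\<close> by simp
  with g show ?thesis by (simp add: poly_ring_deg_iff)
qed

section \<open>The Johnson graph\<close>

text \<open>Equal sizes and an intersection one short leave one element on each side. For
  \<open>k = 0\<close> the truncated \<open>k - 1\<close> would make the empty set adjacent to
  itself.\<close>

lemma edges_iff:
  assumes "0 < k"
  shows "(S, T) \<in> edges n k \<longleftrightarrow>
    S \<in> vertices n k \<and> (\<exists>a\<in>S. \<exists>b\<in>{1..n} - S. T = insert b (S - {a}))"
proof
  assume e: "(S, T) \<in> edges n k"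
  then have S: "S \<subseteq> {1..n}" "card S = k" and T: "T \<subseteq> {1..n}" "card T = k"
    and ST: "card (S \<inter> T) = k - 1"
    by (auto simp: edges_def vertices_def)
  have fin: "finite S" "finite T" using S T finite_subset by blast+
  have "card (S - T) = 1" "card (T - S) = 1"
    using S T ST fin assms card_Diff_subset_Int[of S T] card_Diff_subset_Int[of T S]
    by (simp_all add: Int_commute)
  then obtain a b where ab: "S - T = {a}" "T - S = {b}" by (auto simp: card_1_singleton_iff)
  then have "a \<in> S" "b \<in> {1..n} - S" "T = insert b (S - {a})" using T by blast+
  then show "S \<in> vertices n k \<and> (\<exists>a\<in>S. \<exists>b\<in>{1..n} - S. T = insert b (S - {a}))"
    using S unfolding vertices_def by blast
next
  assume "S \<in> vertices n k \<and> (\<exists>a\<in>S. \<exists>b\<in>{1..n} - S. T = insert b (S - {a}))"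
  then obtain a b where S: "S \<subseteq> {1..n}" "card S = k" and ab: "a \<in> S" "b \<in> {1..n} - S"
    and T: "T = insert b (S - {a})" by (auto simp: vertices_def)
  have fin: "finite S" using S finite_subset by blast
  have "S \<inter> T = S - {a}" using ab T by blast
  then have "card (S \<inter> T) = k - 1" using ab S by simp
  moreover have "card T = k" using ab S T fin assms by (simp add: card_Suc_Diff1)
  ultimately show "(S, T) \<in> edges n k"
    using S T ab by (auto simp: edges_def vertices_def)
qed

lemma edges_vertices: "(S, T) \<in> edges n k \<Longrightarrow> S \<in> vertices n k \<and> T \<in> vertices n k"
  by (simp add: edges_def)

lemma edgesE:
  assumes "0 < k" "(S, T) \<in> edges n k"
  obtains a b where "S \<in> vertices n k" "a \<in> S" "b \<in> {1..n}" "b \<notin> S" "T = insert b (S - {a})"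
  using assms by (auto simp: edges_iff)

lemma exchange_edge:
  assumes "0 < k" "S \<in> vertices n k" "a \<in> S" "b \<in> {1..n}" "b \<notin> S"
  shows "(S, insert b (S - {a})) \<in> edges n k"
  unfolding edges_iff[OF assms(1)] using assms by blast

lemma axial_exchange:
  assumes "a \<in> S" "b \<notin> S"
  shows "axial (S, insert b (S - {a})) = coord b - coord a"
proof -
  have "insert b (S - {a}) - S = {b}" "S - insert b (S - {a}) = {a}" using assms by auto
  then show ?thesis by (simp add: axial_def)
qed

section \<open>Downward edges, index and height\<close>

lemma phi_exchange:
  assumes "finite S" "a \<in> S" "b \<notin> S"
  shows "phi (insert b (S - {a})) + a = phi S + b"
  using assms sum.remove[of S a "\<lambda>i. i"] by (simp add: phi_def)

text \<open>Encodes a downward edge by the element \<open>a\<close> taken out and the smaller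
  element \<open>b\<close> put in; on such pairs a reflection acts entry by entry.\<close>

definition down_pairs :: "nat \<Rightarrow> nat set \<Rightarrow> (nat \<times> nat) set" where
  "down_pairs n S = {(a, b). a \<in> S \<and> b \<in> {1..n} - S \<and> b < a}"

lemma finite_down_pairs: "finite S \<Longrightarrow> finite (down_pairs n S)"
  by (rule finite_subset[of _ "S \<times> {1..n}"]) (auto simp: down_pairs_def)

lemma down_edges_eq:
  assumes "0 < k" "S \<in> vertices n k"
  shows "down_edges n k S = (\<lambda>(a, b). (S, insert b (S - {a}))) ` down_pairs n S"
proof -
  have eval: "eval_at xi (axial (S, insert b (S - {a}))) = real b - real a" if "a \<in> S" "b \<notin> S" for a b
    unfolding axial_exchange[OF that] eval_at_def real.subst_diff real.subst_coord xi_def ..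
  have "(S, T) \<in> down_edges n k S \<longleftrightarrow> (\<exists>(a, b)\<in>down_pairs n S. T = insert b (S - {a}))" for T
  proof
    assume T: "(S, T) \<in> down_edges n k S"
    then obtain a b where ab: "a \<in> S" "b \<in> {1..n}" "b \<notin> S" "T = insert b (S - {a})"
      using assms by (auto simp: down_edges_def edges_from_def elim: edgesE)
    then have "b < a" using T eval by (simp add: down_edges_def)
    with ab show "\<exists>(a, b)\<in>down_pairs n S. T = insert b (S - {a})"
      by (intro bexI[of _ "(a, b)"]) (simp_all add: down_pairs_def)
  next
    assume "\<exists>(a, b)\<in>down_pairs n S. T = insert b (S - {a})"
    then obtain a b where ab: "a \<in> S" "b \<in> {1..n} - S" "b < a" "T = insert b (S - {a})"
      by (auto simp: down_pairs_def)
    then have "(S, T) \<in> edges n k" using assms exchange_edge by blast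
    with ab eval show "(S, T) \<in> down_edges n k S"
      by (simp add: down_edges_def edges_from_def)
  qed
  moreover have "fst e = S" if "e \<in> down_edges n k S" for e
    using that by (simp add: down_edges_def edges_from_def)
  ultimately have "e \<in> down_edges n k S \<longleftrightarrow>
      fst e = S \<and> (\<exists>(a, b)\<in>down_pairs n S. snd e = insert b (S - {a}))" for e
    by (metis prod.collapse)
  then show ?thesis by (simp add: set_eq_iff image_iff case_prod_unfold prod_eq_iff)
qed

text \<open>The two elements exchanged are recovered as the set differences of the end
  points.\<close>

lemma inj_on_exchange: "inj_on (\<lambda>(a, b). (S, insert b (S - {a}))) (down_pairs n S)"
proof (rule inj_onI, clarsimp simp: down_pairs_def)
  fix a b a' b'
  assume *: "a \<in> S" "b \<notin> S" "a' \<in> S" "b' \<notin> S" "insert b (S - {a}) = insert b' (S - {a'})"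
  then have "S - insert b (S - {a}) = S - insert b' (S - {a'})"
    "insert b (S - {a}) - S = insert b' (S - {a'}) - S" by simp_all
  with * show "a = a' \<and> b = b'" by blast
qed

lemma index_eq_card:
  assumes "0 < k" "S \<in> vertices n k"
  shows "index n k S = card (down_pairs n S)"
  unfolding index_def down_edges_eq[OF assms] by (rule card_image[OF inj_on_exchange])

lemma prod_down_edges:
  assumes "0 < k" "S \<in> vertices n k"
  shows "(\<Prod>e\<in>down_edges n k S. axial e) = (\<Prod>(a, b)\<in>down_pairs n S. coord b - coord a)"
  unfolding down_edges_eq[OF assms] prod.reindex[OF inj_on_exchange]
  by (rule prod.cong) (auto simp: down_pairs_def axial_exchange)

text \<open>The numbers from 1 to \<open>a\<close> are the smaller non-members of \<open>S\<close>,
  counted by the index, the smaller members, and \<open>a\<close> itself. Summed over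
  \<open>S\<close>, the last two kinds give constants, so \<open>phi\<close> and the index rise
  together.\<close>

lemma phi_eq_index:
  assumes "0 < k" "S \<in> vertices n k"
  shows "phi S = index n k S + (\<Sum>i<k. i) + k"
proof -
  have S: "S \<subseteq> {1..n}" "card S = k" "finite S"
    using assms finite_subset by (auto simp: vertices_def)
  have smaller: "(\<Sum>a\<in>S. card {b\<in>S. b < a}) = (\<Sum>i<card S. i)"
    using \<open>finite S\<close>
  proof (induction S rule: finite_linorder_max_induct)
    case (insert m A)
    \<comment> \<open>The new maximum \<open>m\<close> has all of \<open>A\<close> below it and
      changes no other count.\<close>
    have "{b \<in> insert m A. b < m} = A" using insert(2) by auto
    moreover have "{b \<in> insert m A. b < a} = {b \<in> A. b < a}" if "a \<in> A" for a
      using insert(2) that by force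
    moreover have "m \<notin> A" using insert(2) by auto
    ultimately show ?case using insert by simp
  qed simp
  have "down_pairs n S = (SIGMA a:S. {b \<in> {1..n} - S. b < a})"
    by (auto simp: down_pairs_def)
  then have "index n k S = (\<Sum>a\<in>S. card {b \<in> {1..n} - S. b < a})"
    using assms S by (simp add: index_eq_card card_SigmaI)
  moreover have "card {b \<in> {1..n} - S. b < a} + card {b\<in>S. b < a} + 1 = a" if "a \<in> S" for a
  proof -
    have "{b \<in> {1..n} - S. b < a} \<union> {b\<in>S. b < a} = {1..<a}" using S that by fastforce
    then have "card {b \<in> {1..n} - S. b < a} + card {b\<in>S. b < a} = card {1..<a}"
      using \<open>finite S\<close> by (subst card_Un_disjoint[symmetric]) auto
    then show ?thesis using S that by auto
  qed
  then have "phi S = (\<Sum>a\<in>S. card {b \<in> {1..n} - S. b < a} + card {b\<in>S. b < a} + 1)"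
    unfolding phi_def by (intro sum.cong) simp_all
  ultimately show ?thesis using smaller S by (simp add: sum.distrib sum_Suc)
qed

lemma flow_up_refl: "p \<in> vertices n k \<Longrightarrow> p \<in> flow_up n k p"
  by (simp add: flow_up_def)

lemma flow_up_phi:
  assumes "q \<in> flow_up n k p" "q \<noteq> p"
  shows "phi p < phi q"
proof -
  have "(p, q) \<in> {(a, b) \<in> edges n k. phi a < phi b}\<^sup>*" using assms by (simp add: flow_up_def)
  then have "phi p < phi q \<or> p = q" by (induction rule: rtrancl_induct) auto
  with assms show ?thesis by simp
qed

section \<open>Thom classes\<close>

lemma axial_ne_0: "0 < k \<Longrightarrow> (S, T) \<in> edges n k \<Longrightarrow> axial (S, T) \<noteq> 0"
  by (erule (1) edgesE) (auto simp: axial_exchange coord_eq_iff)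

lemma vertices_subset: "S \<in> vertices n k \<Longrightarrow> S \<subseteq> {1..n}"
  by (simp add: vertices_def)

lemma axial_in_poly_ring: "0 < k \<Longrightarrow> (S, T) \<in> edges n k \<Longrightarrow> axial (S, T) \<in> poly_ring n"
proof -
  assume "0 < k" "(S, T) \<in> edges n k"
  then obtain a b where ab: "S \<in> vertices n k" "a \<in> S" "b \<in> {1..n}" "b \<notin> S" "T = insert b (S - {a})"
    by (rule edgesE)
  then have "a \<in> {1..n}" using vertices_subset by blast
  with ab show ?thesis by (simp add: axial_exchange poly_ring_diff coord_in_poly_ring)
qed

text \<open>By \<open>poly_ring_cancel\<close> the quotient by a nonzero label lies in
  \<open>poly_ring n\<close> again, so the congruences amount to plain divisibility.\<close>

lemma cohom_iff:
  assumes "0 < k"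
  shows "f \<in> cohom n k \<longleftrightarrow> f \<in> vertices n k \<rightarrow>\<^sub>E poly_ring n
    \<and> (\<forall>p q. (p, q) \<in> edges n k \<longrightarrow> axial (p, q) dvd f p - f q)"
proof -
  have "(\<exists>g\<in>poly_ring n. f p - f q = axial (p, q) * g) \<longleftrightarrow> axial (p, q) dvd f p - f q"
    if "f \<in> vertices n k \<rightarrow>\<^sub>E poly_ring n" "(p, q) \<in> edges n k" for p q
  proof
    assume "axial (p, q) dvd f p - f q"
    then obtain g where g: "f p - f q = axial (p, q) * g" by (elim dvdE)
    have "f p - f q \<in> poly_ring n"
      using that edges_vertices[OF that(2)] by (auto intro: poly_ring_diff)
    then have "g \<in> poly_ring n"
      unfolding g using poly_ring_cancel axial_in_poly_ring[OF assms that(2)]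
        axial_ne_0[OF assms that(2)] by blast
    with g show "\<exists>g\<in>poly_ring n. f p - f q = axial (p, q) * g" by blast
  qed auto
  then show ?thesis unfolding cohom_def by fastforce
qed

lemma poly_ring_deg_diff:
  "f \<in> poly_ring_deg n d \<Longrightarrow> g \<in> poly_ring_deg n d \<Longrightarrow> f - g \<in> poly_ring_deg n d"
  by (simp add: poly_ring_deg_iff poly_ring_diff grading_hom diff_monom)

text \<open>Strong induction on \<open>phi\<close> takes the place of choosing a minimal vertex in
  the support of \<open>f - g\<close>.\<close>

lemma is_thom_class_unique:
  assumes "0 < k" "p \<in> vertices n k" "is_thom_class n k p f" "is_thom_class n k p g"
  shows "f = g"
proof -
  have f: "f \<in> vertices n k \<rightarrow>\<^sub>E poly_ring n" and g: "g \<in> vertices n k \<rightarrow>\<^sub>E poly_ring n"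
    using assms by (simp_all add: is_thom_class_def cohom_even_def cohom_def)
  have dvd: "axial (q, q') dvd (f q - g q) - (f q' - g q')" if "(q, q') \<in> edges n k" for q q'
  proof -
    have "axial (q, q') dvd (f q - f q') - (g q - g q')"
      using assms that by (intro dvd_diff[of _ "f q - f q'"]) (simp_all add: is_thom_class_def cohom_even_def cohom_iff)
    then show ?thesis by (simp add: algebra_simps)
  qed
  have "f q = g q" if "q \<in> vertices n k" for q
    using that
  proof (induction q rule: measure_induct_rule[of phi])
    case (less q)
    show ?case
    proof (cases "q \<in> flow_up n k p \<and> q \<noteq> p")
      \<comment> \<open>Off the flow-up of \<open>p\<close> both classes vanish, and at
        \<open>p\<close> both take the prescribed value.\<close>
      case False
      then show ?thesis using assms less.prems by (auto simp: is_thom_class_def)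
    next
      case True
      then have "phi p < phi q" using flow_up_phi by blast
      then have lt: "index n k p < card (down_pairs n q)"
        using assms less.prems by (simp add: phi_eq_index index_eq_card)
      have fin: "finite q" using vertices_subset[OF less.prems] finite_subset by blast
      have "coord b - coord a dvd f q - g q" if "(a, b) \<in> down_pairs n q" for a b
      proof -
        let ?q = "insert b (q - {a})"
        have ab: "a \<in> q" "b \<notin> q" "b \<in> {1..n}" "b < a" using that by (auto simp: down_pairs_def)
        then have e: "(q, ?q) \<in> edges n k" using less.prems assms by (intro exchange_edge)
        have "phi ?q < phi q" using phi_exchange[OF fin ab(1,2)] ab(4) by simp
        \<comment> \<open>The lower end of the edge is settled by induction, so the label divides
          \<open>f q - g q\<close> itself.\<close>
        then have "f ?q = g ?q" using less.IH e edges_vertices by blast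
        then show ?thesis using dvd[OF e] ab by (simp add: axial_exchange)
      qed
      then have "(\<Prod>(a, b)\<in>down_pairs n q. coord b - coord a) dvd f q - g q"
        using fin by (intro prod_coord_diff_dvd finite_down_pairs) (auto simp: down_pairs_def)
      then obtain u where "f q - g q = (\<Prod>(a, b)\<in>down_pairs n q. coord b - coord a) * u" by (elim dvdE)
      moreover have "f q - g q \<in> poly_ring_deg n (index n k p)"
        using assms less.prems
        by (intro poly_ring_deg_diff) (simp_all add: is_thom_class_def cohom_even_def)
      \<comment> \<open>There are more linear factors than the degree of a nonzero difference
        allows.\<close>
      ultimately have "f q - g q = 0"
        using lt grading_prod_coord_diff by (metis poly_ring_deg_eq_0)
      then show ?thesis by simp
    qed
  qed
  then show ?thesis using f g by (metis PiE_ext)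
qed

lemma thom_class_eqI:
  assumes "0 < k" "p \<in> vertices n k" "is_thom_class n k p f"
  shows "thom_class n k p = f"
  unfolding thom_class_def using assms is_thom_class_unique by blast

lemma prod_down_pairs_in_poly_ring_deg:
  assumes "S \<subseteq> {1..n}"
  shows "(\<Prod>(a, b)\<in>down_pairs n S. coord b - coord a) \<in> poly_ring_deg n (card (down_pairs n S))"
  unfolding poly_ring_deg_iff grading_prod_coord_diff using assms
  by (auto simp: down_pairs_def intro!: poly_ring_prod poly_ring_diff coord_in_poly_ring)

lemma poly_ring_deg_0: "0 \<in> poly_ring_deg n d"
  by (simp add: poly_ring_deg_def poly_ring_0)

text \<open>Elements outside the top vertex are smaller than those in it, so every edge at
  \<open>p0\<close> goes down and its label is a factor of the value there. All other edges join
  zeros.\<close>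

lemma is_thom_class_top:
  assumes "0 < k" "k < n"
  defines "p0 \<equiv> {n - k + 1..n}"
  defines "f \<equiv> \<lambda>q\<in>vertices n k. if q = p0 then \<Prod>(a, b)\<in>down_pairs n p0. coord b - coord a else 0"
  shows "is_thom_class n k p0 f"
proof -
  have p0: "p0 \<in> vertices n k" using assms by (auto simp: vertices_def)
  let ?P = "\<Prod>(a, b)\<in>down_pairs n p0. coord b - coord a"
  have P: "?P \<in> poly_ring_deg n (index n k p0)"
    using prod_down_pairs_in_poly_ring_deg[OF vertices_subset[OF p0]] p0 assms
    by (simp add: index_eq_card)
  have dvd: "coord b - coord a dvd ?P" if "a \<in> p0" "b \<in> {1..n}" "b \<notin> p0" for a b
  proof -
    have "(a, b) \<in> down_pairs n p0" using that by (auto simp: down_pairs_def p0_def)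
    then have "(case (a, b) of (a, b) \<Rightarrow> coord b - coord a) dvd ?P"
      by (intro dvd_prodI finite_down_pairs) (simp_all add: p0_def)
    then show ?thesis by simp
  qed
  have "axial (p, q) dvd f p - f q" if e: "(p, q) \<in> edges n k" for p q
  proof -
    obtain a b where ab: "p \<in> vertices n k" "a \<in> p" "b \<in> {1..n}" "b \<notin> p" "q = insert b (p - {a})"
      using e assms edgesE by metis
    have q: "q \<in> vertices n k" using e edges_vertices by blast
    have "p \<noteq> q" using ab by blast
    have "coord b - coord a dvd ?P" if "q = p0"
    proof -
      \<comment> \<open>An edge ending at \<open>p0\<close> is the reverse of a downward edge, so
        the factor of the product is the negative of its label.\<close>
      have "coord a - coord b dvd ?P"
        using that ab vertices_subset[OF ab(1)] by (intro dvd) auto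
      then show ?thesis using minus_dvd_iff[of "coord a - coord b"] by simp
    qed
    then show ?thesis using ab q \<open>p \<noteq> q\<close> dvd[of a b] by (auto simp: f_def axial_exchange)
  qed
  moreover have "f q \<in> poly_ring_deg n (index n k p0)" if "q \<in> vertices n k" for q
    using that P by (simp add: f_def poly_ring_deg_0)
  moreover have "f \<in> extensional (vertices n k)" by (simp add: f_def)
  ultimately have "f \<in> cohom_even n k (index n k p0)"
    using assms by (auto simp: cohom_even_def cohom_iff poly_ring_deg_iff PiE_def)
  then show ?thesis
    using p0 assms by (auto simp: is_thom_class_def prod_down_edges f_def flow_up_refl)
qed

section \<open>Elementary reflections\<close>

lemma elem_refl_elem_refl [simp]: "elem_refl i (elem_refl i a) = a"
  by (simp add: elem_refl_def)

lemma elem_refl_eq_iff [simp]: "elem_refl i a = elem_refl i b \<longleftrightarrow> a = b"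
  by (metis elem_refl_elem_refl)

lemma inj_elem_refl: "inj_on (elem_refl i) A"
  by (simp add: inj_on_def)

lemma inv_elem_refl: "inv (elem_refl i) = elem_refl i"
  by (rule inv_equality) simp_all

lemma elem_refl_mem: "i \<in> {1..n - 1} \<Longrightarrow> elem_refl i a \<in> {1..n} \<longleftrightarrow> a \<in> {1..n}"
  by (auto simp: elem_refl_def Transposition.transpose_def)

text \<open>An adjacent transposition reverses the order of one pair only; the lifting property and
  the comparison of downward pairs both rest on this.\<close>

lemma elem_refl_less: "b < a \<Longrightarrow> (a, b) \<noteq> (i + 1, i) \<Longrightarrow> elem_refl i b < elem_refl i a"
  by (auto simp: elem_refl_def Transposition.transpose_def)

lemma mem_refl_vertex: "a \<in> refl_vertex i S \<longleftrightarrow> elem_refl i a \<in> S"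
  unfolding refl_vertex_def by (metis (no_types) elem_refl_elem_refl image_iff)

lemma refl_vertex_refl_vertex [simp]: "refl_vertex i (refl_vertex i S) = S"
  by (simp add: set_eq_iff mem_refl_vertex)

lemma refl_vertex_exchange:
  "refl_vertex i (insert b (S - {a})) = insert (elem_refl i b) (refl_vertex i S - {elem_refl i a})"
  by (simp add: refl_vertex_def image_set_diff[OF inj_elem_refl])

lemma refl_vertex_in_vertices:
  assumes "i \<in> {1..n - 1}" "S \<in> vertices n k"
  shows "refl_vertex i S \<in> vertices n k"
proof -
  have "refl_vertex i S \<subseteq> {1..n}"
    using assms elem_refl_mem[OF assms(1)] by (auto simp: refl_vertex_def vertices_def)
  moreover have "card (refl_vertex i S) = card S"
    unfolding refl_vertex_def by (rule card_image[OF inj_elem_refl])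
  ultimately show ?thesis using assms by (simp add: vertices_def)
qed

lemma refl_vertex_eq_exchange:
  assumes "i \<in> S" "i + 1 \<notin> S"
  shows "refl_vertex i S = insert (i + 1) (S - {i})"
  using assms by (auto simp: set_eq_iff mem_refl_vertex elem_refl_def Transposition.transpose_def)

lemma refl_vertex_cases:
  obtains (up) "i \<in> S" "i + 1 \<notin> S" | (down) "i \<notin> S" "i + 1 \<in> S" | (fixed) "refl_vertex i S = S"
proof -
  have "refl_vertex i S = S" if "i \<in> S \<longleftrightarrow> i + 1 \<in> S"
    using that by (auto simp: set_eq_iff mem_refl_vertex elem_refl_def Transposition.transpose_def)
  then show thesis using that by blast
qed

lemma phi_refl_vertex_up:
  assumes "finite S" "i \<in> S" "i + 1 \<notin> S"
  shows "phi (refl_vertex i S) = phi S + 1"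
  using phi_exchange[OF assms] by (simp only: refl_vertex_eq_exchange[OF assms(2,3)])

lemma phi_refl_vertex_lessD:
  assumes "finite S" "phi S < phi (refl_vertex i S)"
  shows "i \<in> S \<and> i + 1 \<notin> S"
proof (cases rule: refl_vertex_cases[of i S])
  case down
  \<comment> \<open>Here the reflected vertex is the one that moves up, so \<open>phi\<close> would
    drop from \<open>S\<close> to \<open>?T\<close>.\<close>
  let ?T = "refl_vertex i S"
  have "finite ?T" using assms(1) by (simp add: refl_vertex_def)
  moreover have "i \<in> ?T" "i + 1 \<notin> ?T" using down by (simp_all add: mem_refl_vertex elem_refl_def)
  ultimately show ?thesis using phi_refl_vertex_up[of ?T i] assms by simp
qed (use assms in auto)

lemma refl_vertex_edge:
  assumes "0 < k" "i \<in> {1..n - 1}" "(S, T) \<in> edges n k"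
  shows "(refl_vertex i S, refl_vertex i T) \<in> edges n k"
proof -
  obtain a b where ab: "S \<in> vertices n k" "a \<in> S" "b \<in> {1..n}" "b \<notin> S" "T = insert b (S - {a})"
    using assms edgesE by metis
  show ?thesis
    unfolding ab(5) refl_vertex_exchange using ab(1-4) assms elem_refl_mem[OF assms(2)]
    by (intro exchange_edge refl_vertex_in_vertices) (simp_all add: mem_refl_vertex)
qed

section \<open>Action of the reflections on polynomials\<close>

lemmas refl_poly_hom = const.subst_simps[of "\<lambda>j. coord (elem_refl i j)" for i, folded refl_poly_def]

lemma refl_poly_0 [simp]: "refl_poly i 0 = 0"
  by (simp add: refl_poly_def)

lemma refl_poly_const: "refl_poly i (const c) = const c"
  by (simp add: refl_poly_def)

lemma refl_poly_coord: "refl_poly i (coord j) = coord (elem_refl i j)"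
  by (simp add: refl_poly_def)

lemma refl_poly_refl_poly [simp]: "refl_poly i (refl_poly i f) = f"
  by (induction f rule: rpoly_induct) (simp_all add: refl_poly_hom refl_poly_const refl_poly_coord)

lemma refl_poly_in_poly_ring:
  assumes "f \<in> poly_ring n" "i \<in> {1..n - 1}"
  shows "refl_poly i f \<in> poly_ring n"
proof -
  \<comment> \<open>Sending the variables outside the range to 0 puts every substituted value in
    \<open>poly_ring n\<close> and leaves the result for \<open>f\<close> unchanged.\<close>
  have "refl_poly i f = subst_poly const (\<lambda>j. if j \<in> {1..n} then coord (elem_refl i j) else 0) f"
    unfolding refl_poly_def by (rule subst_poly_cong[OF assms(1)]) simp
  also have "\<dots> \<in> poly_ring n"
    using elem_refl_mem[OF assms(2)]
    by (intro subst_poly_in_poly_ring) (simp add: coord_in_poly_ring poly_ring_0 del: atLeastAtMost_iff)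
  finally show ?thesis .
qed

text \<open>A permutation of the variables preserves degrees, so it acts on each coefficient of the
  grading separately.\<close>

lemma grading_refl_poly: "grading (refl_poly i f) = map_poly (refl_poly i) (grading f)"
proof (induction f rule: rpoly_induct)
  case (const c)
  show ?case by (simp add: refl_poly_const grading_def map_poly_pCons)
next
  case (coord j)
  show ?case by (simp add: refl_poly_coord grading_coord map_poly_monom)
next
  case (add f g)
  then show ?case by (simp add: refl_poly_hom grading_hom poly_eq_iff coeff_map_poly)
next
  case (mult f g)
  have sum: "refl_poly i (\<Sum>j\<in>I. u j) = (\<Sum>j\<in>I. refl_poly i (u j))" for I :: "nat set" and u
    by (induction I rule: infinite_finite_induct) (simp_all add: refl_poly_hom)
  show ?case
    using mult by (simp add: refl_poly_hom grading_hom poly_eq_iff coeff_map_poly coeff_mult sum)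
qed

lemma refl_poly_in_poly_ring_deg:
  "f \<in> poly_ring_deg n d \<Longrightarrow> i \<in> {1..n - 1} \<Longrightarrow> refl_poly i f \<in> poly_ring_deg n d"
  by (simp add: poly_ring_deg_iff refl_poly_in_poly_ring grading_refl_poly map_poly_monom)

lemma coord_diff_dvd_refl_poly: "coord i - coord (i + 1) dvd f - refl_poly i f"
  unfolding refl_poly_def
proof (rule dvd_diff_subst_poly)
  fix j
  show "coord i - coord (i + 1) dvd coord j - coord (elem_refl i j)"
    using dvd_minus_iff[of "coord i - coord (i + 1)" "coord i - coord (i + 1)"]
    by (auto simp: elem_refl_def Transposition.transpose_def)
qed

text \<open>Equivariance of the labels, by which divided differences respect the congruences along
  edges.\<close>

lemma refl_poly_axial:
  assumes "0 < k" "(S, T) \<in> edges n k"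
  shows "refl_poly i (axial (S, T)) = axial (refl_vertex i S, refl_vertex i T)"
proof -
  obtain a b where ab: "a \<in> S" "b \<notin> S" "T = insert b (S - {a})"
    using assms edgesE by metis
  then show ?thesis
    by (simp add: refl_vertex_exchange axial_exchange mem_refl_vertex refl_poly_hom refl_poly_coord)
qed

lemma refl_poly_dvd: "p dvd f \<Longrightarrow> refl_poly i p dvd refl_poly i f"
  by (auto elim!: dvdE simp: refl_poly_hom)

section \<open>Divided differences of Thom classes\<close>

lemma coord_diff_ne_0: "coord i - coord (i + 1) \<noteq> 0"
  by (simp add: coord_eq_iff)

lemma coord_diff_in_poly_ring_deg:
  assumes "i \<in> {1..n - 1}"
  shows "coord i - coord (i + 1) \<in> poly_ring_deg n 1"
  using assms
  by (auto simp: poly_ring_deg_iff grading_hom grading_coord diff_monom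
      intro!: poly_ring_diff coord_in_poly_ring)

context
  fixes n k i :: nat and f :: "nat set \<Rightarrow> rpoly"
  assumes k: "0 < k" and i: "i \<in> {1..n - 1}" and f: "f \<in> cohom n k"
begin

lemma cohom_dvd: "(p, q) \<in> edges n k \<Longrightarrow> axial (p, q) dvd f p - f q"
  using f k by (simp add: cohom_iff)

lemma cohom_in_poly_ring: "p \<in> vertices n k \<Longrightarrow> f p \<in> poly_ring n"
  using f by (auto simp: cohom_def)

text \<open>The numerator is the sum of \<open>f p - f (refl_vertex i p)\<close>, which is zero or a
  difference along an edge labelled by the linear form up to sign, and of the change of a polynomial
  under the reflection, again a multiple of that form.\<close>

lemma coord_diff_dvd_cohom:
  assumes p: "p \<in> vertices n k"
  shows "coord i - coord (i + 1) dvd f p - refl_poly i (f (refl_vertex i p))"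
proof -
  let ?d = "coord i - coord (i + 1)" and ?q = "refl_vertex i p"
  have up: "?d dvd f p - f (refl_vertex i p)" if "p \<in> vertices n k" "i \<in> p" "i + 1 \<notin> p" for p
  proof -
    have *: "refl_vertex i p = insert (i + 1) (p - {i})" using that by (simp add: refl_vertex_eq_exchange)
    then have "(p, refl_vertex i p) \<in> edges n k" using k i that by (auto intro: exchange_edge)
    then have "coord (i + 1) - coord i dvd f p - f (refl_vertex i p)"
      using cohom_dvd[of p "refl_vertex i p"] that by (simp add: * axial_exchange)
    then show ?thesis using minus_dvd_iff[of "coord (i + 1) - coord i"] by simp
  qed
  have "?d dvd f p - f ?q"
  proof (cases rule: refl_vertex_cases[of i p])
    case down
    have "?q \<in> vertices n k" "i \<in> ?q" "i + 1 \<notin> ?q"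
      using down p i by (auto simp: refl_vertex_in_vertices mem_refl_vertex elem_refl_def)
    then have "?d dvd f ?q - f p" using up[of ?q] by simp
    then show ?thesis using dvd_minus_iff[of ?d "f ?q - f p"] by simp
  qed (use p up in auto)
  then have "?d dvd (f p - f ?q) + (f ?q - refl_poly i (f ?q))"
    by (intro dvd_add coord_diff_dvd_refl_poly)
  then show ?thesis by simp
qed

text \<open>Shows that the exact quotient exists. Later arguments use the multiplied-out equation
  and cancel the linear form.\<close>

lemma div_diff_spec:
  assumes p: "p \<in> vertices n k"
  shows div_diff_in_poly_ring: "div_diff n k i f p \<in> poly_ring n"
    and coord_diff_mult_div_diff:
      "(coord i - coord (i + 1)) * div_diff n k i f p = f p - refl_poly i (f (refl_vertex i p))"
proof -
  let ?d = "coord i - coord (i + 1)"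
  obtain g where g: "f p - refl_poly i (f (refl_vertex i p)) = ?d * g"
    using coord_diff_dvd_cohom[OF p] by (elim dvdE)
  have "f p - refl_poly i (f (refl_vertex i p)) \<in> poly_ring n"
    using p i by (intro poly_ring_diff refl_poly_in_poly_ring cohom_in_poly_ring refl_vertex_in_vertices)
  then have g_in: "g \<in> poly_ring n"
    unfolding g using coord_diff_in_poly_ring_deg[OF i] coord_diff_ne_0 poly_ring_cancel
    by (meson poly_ring_deg_iff)
  have "div_diff n k i f p = exact_quot n (f p - refl_poly i (f (refl_vertex i p))) ?d"
    using p by (simp add: div_diff_def inv_elem_refl refl_vertex_def)
  also have "\<dots> = g" by (rule exact_quot_eqI[OF g_in g[symmetric] coord_diff_ne_0])
  finally show "div_diff n k i f p \<in> poly_ring n" "?d * div_diff n k i f p = f p - refl_poly i (f (refl_vertex i p))"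
    using g g_in by simp_all
qed

text \<open>The reflection turns the numerator at \<open>p\<close> into minus the numerator at the
  reflected vertex, and the denominator into its negative.\<close>

lemma refl_poly_div_diff:
  assumes p: "p \<in> vertices n k"
  shows "refl_poly i (div_diff n k i f p) = div_diff n k i f (refl_vertex i p)"
proof -
  let ?d = "coord i - coord (i + 1)"
  have "refl_poly i ?d = - ?d"
    by (simp add: refl_poly_hom refl_poly_coord elem_refl_def)
  then have "- ?d * refl_poly i (div_diff n k i f p) = refl_poly i (?d * div_diff n k i f p)"
    by (simp only: refl_poly_hom(2))
  also have "\<dots> = - (f (refl_vertex i p) - refl_poly i (f (refl_vertex i (refl_vertex i p))))"
    unfolding coord_diff_mult_div_diff[OF p] by (simp add: refl_poly_hom)
  also have "\<dots> = - ?d * div_diff n k i f (refl_vertex i p)"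
    unfolding mult_minus_left coord_diff_mult_div_diff[OF refl_vertex_in_vertices[OF i p]] ..
  finally show ?thesis using coord_diff_ne_0[of i] by simp
qed

text \<open>An edge labelled by the denominator up to sign joins \<open>p\<close> to its reflection,
  and there the two values are reflections of each other. On all other edges the label is coprime to
  the denominator.\<close>

lemma div_diff_in_cohom: "div_diff n k i f \<in> cohom n k"
proof -
  let ?d = "coord i - coord (i + 1)" and ?D = "div_diff n k i f"
  have "axial (p, q) dvd ?D p - ?D q" if e: "(p, q) \<in> edges n k" for p q
  proof -
    obtain a b where ab: "p \<in> vertices n k" "a \<in> p" "b \<in> {1..n}" "b \<notin> p" "q = insert b (p - {a})"
      using e k edgesE by metis
    have q: "q \<in> vertices n k" using e edges_vertices by blast
    have axial: "axial (p, q) = coord b - coord a" using ab by (simp add: axial_exchange)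
    show ?thesis
    proof (cases "{a, b} = {i, i + 1}")
      case True
      then consider "a = i" "b = i + 1" | "a = i + 1" "b = i" by (auto simp: doubleton_eq_iff)
      then have q_eq: "q = refl_vertex i p"
      proof cases
        case 1
        then show ?thesis using ab refl_vertex_eq_exchange[of i p] by simp
      next
        case 2
        then have "refl_vertex i q = insert (i + 1) (q - {i})"
          using ab by (intro refl_vertex_eq_exchange) simp_all
        also have "\<dots> = p" using ab 2 by auto
        finally show ?thesis by (metis refl_vertex_refl_vertex)
      qed
      have "?d dvd ?D p - ?D q"
        using coord_diff_dvd_refl_poly[of i "?D p"] ab(1) by (simp add: q_eq refl_poly_div_diff)
      moreover have "axial (p, q) = ?d \<or> axial (p, q) = - ?d"
        using True axial by (auto simp: doubleton_eq_iff)
      ultimately show ?thesis using minus_dvd_iff by metis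
    next
      case False
      have "axial (refl_vertex i p, refl_vertex i q) dvd f (refl_vertex i p) - f (refl_vertex i q)"
        using e k i by (intro cohom_dvd refl_vertex_edge)
      \<comment> \<open>Reflecting the congruence along the reflected edge brings its label back to
        \<open>axial (p, q)\<close>.\<close>
      then have "axial (p, q) dvd refl_poly i (f (refl_vertex i p) - f (refl_vertex i q))"
        using refl_poly_dvd refl_poly_axial[OF k refl_vertex_edge[OF k i e], of i]
        by (metis refl_vertex_refl_vertex)
      then have "axial (p, q) dvd (f p - f q) - refl_poly i (f (refl_vertex i p) - f (refl_vertex i q))"
        using cohom_dvd[OF e] by (intro dvd_diff[of _ "f p - f q"])
      also have "\<dots> = ?d * (?D p - ?D q)"
        unfolding right_diff_distrib coord_diff_mult_div_diff[OF ab(1)] coord_diff_mult_div_diff[OF q]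
        by (simp add: refl_poly_hom)
      finally have "merge a b (?d * (?D p - ?D q)) = 0"
        unfolding axial coord_diff_dvd_iff .
      \<comment> \<open>The denominator survives \<open>merge a b\<close>, so the other factor is
        the one that is killed.\<close>
      moreover have "merge a b ?d \<noteq> 0"
        using False ab merge_coord_diff_eq_0_iff[of a b i "i + 1"] by (auto simp: insert_commute)
      ultimately have "merge a b (?D p - ?D q) = 0"
        by (simp only: merge_hom(2) mult_eq_0_iff simp_thms)
      then show ?thesis unfolding axial coord_diff_dvd_iff .
    qed
  qed
  moreover have "?D \<in> vertices n k \<rightarrow>\<^sub>E poly_ring n"
    using div_diff_in_poly_ring by (auto simp: div_diff_def)
  ultimately show ?thesis using k by (simp add: cohom_iff)
qed

end

text \<open>Lifting property of the Bruhat order. Along an ascending path from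
  \<open>refl_vertex i p\<close>, the vertex reached and its reflection are both kept reachable from
  \<open>p\<close>; where a step is the reflection itself, the first claim feeds the second.\<close>

lemma flow_up_refl_vertex:
  assumes "0 < k" "i \<in> {1..n - 1}" "p \<in> vertices n k" "i \<in> p" "i + 1 \<notin> p"
    and w: "w \<in> flow_up n k (refl_vertex i p)"
  shows "w \<in> flow_up n k p \<and> refl_vertex i w \<in> flow_up n k p"
proof -
  let ?R = "{(a, b) \<in> edges n k. phi a < phi b}"
  have fin: "finite S" if "S \<in> vertices n k" for S
    using vertices_subset[OF that] finite_subset by blast
  have "(refl_vertex i p, w) \<in> ?R\<^sup>*" using w by (simp add: flow_up_def)
  then have "(p, w) \<in> ?R\<^sup>* \<and> (p, refl_vertex i w) \<in> ?R\<^sup>*"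
  proof (induction rule: rtrancl_induct)
    case base
    have "(p, refl_vertex i p) \<in> edges n k"
      unfolding refl_vertex_eq_exchange[OF assms(4,5)] using assms by (intro exchange_edge) auto
    then have "(p, refl_vertex i p) \<in> ?R"
      using phi_refl_vertex_up[OF fin[OF assms(3)] assms(4,5)] by simp
    then show ?case by auto
  next
    case (step v w)
    then have e: "(v, w) \<in> edges n k" and lt: "phi v < phi w" by auto
    obtain a b where ab: "v \<in> vertices n k" "a \<in> v" "b \<in> {1..n}" "b \<notin> v" "w = insert b (v - {a})"
      using e assms edgesE by metis
    have "a < b" using phi_exchange[OF fin[OF ab(1)] ab(2,4)] lt ab(5) by simp
    have "(p, refl_vertex i w) \<in> ?R\<^sup>*"
    proof (cases "(b, a) = (i + 1, i)")
      case True
      \<comment> \<open>Exchanging \<open>i\<close> for \<open>i + 1\<close> is the reflection, so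
        reflecting \<open>w\<close> gives back the earlier vertex \<open>v\<close>.\<close>
      then have "w = refl_vertex i v" using ab refl_vertex_eq_exchange[of i v] by simp
      then show ?thesis using step.IH by simp
    next
      case False
      \<comment> \<open>Every other ascending exchange stays ascending after reflection.\<close>
      then have "elem_refl i a < elem_refl i b" using elem_refl_less \<open>a < b\<close> by blast
      moreover have "phi (refl_vertex i w) + elem_refl i a = phi (refl_vertex i v) + elem_refl i b"
        unfolding ab(5) refl_vertex_exchange using ab fin[OF ab(1)]
        by (intro phi_exchange) (simp_all add: mem_refl_vertex, simp add: refl_vertex_def)
      moreover have "(refl_vertex i v, refl_vertex i w) \<in> edges n k"
        using assms e by (intro refl_vertex_edge)
      ultimately have "(refl_vertex i v, refl_vertex i w) \<in> ?R" by simp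
      then show ?thesis using step.IH by (meson rtrancl.rtrancl_into_rtrancl)
    qed
    moreover have "(p, w) \<in> ?R\<^sup>*" using step by (meson rtrancl.rtrancl_into_rtrancl)
    ultimately show ?case by blast
  qed
  moreover have "w \<in> vertices n k" using w by (simp add: flow_up_def)
  ultimately show ?thesis using assms by (simp add: flow_up_def refl_vertex_in_vertices)
qed

text \<open>The reflection keeps the order of all pairs but \<open>(i + 1, i)\<close>. That pair is
  downward at the reflected vertex, while its preimage \<open>(i, i + 1)\<close> is ascending at
  \<open>p\<close>.\<close>

lemma down_pairs_refl_vertex:
  assumes "i \<in> {1..n - 1}" "i \<in> p" "i + 1 \<notin> p"
  shows "down_pairs n (refl_vertex i p)
    = insert (i + 1, i) (map_prod (elem_refl i) (elem_refl i) ` down_pairs n p)"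
proof (intro equalityI subsetI)
  fix c assume c: "c \<in> down_pairs n (refl_vertex i p)"
  then obtain a b where ab: "c = (a, b)" "elem_refl i a \<in> p" "b \<in> {1..n}" "elem_refl i b \<notin> p" "b < a"
    by (auto simp: down_pairs_def mem_refl_vertex)
  have "c \<in> map_prod (elem_refl i) (elem_refl i) ` down_pairs n p" if "(a, b) \<noteq> (i + 1, i)"
  proof (rule image_eqI)
    show "c = map_prod (elem_refl i) (elem_refl i) (elem_refl i a, elem_refl i b)" using ab by simp
    show "(elem_refl i a, elem_refl i b) \<in> down_pairs n p"
      using ab that elem_refl_less elem_refl_mem[OF assms(1)] by (simp add: down_pairs_def)
  qed
  then show "c \<in> insert (i + 1, i) (map_prod (elem_refl i) (elem_refl i) ` down_pairs n p)"
    using ab(1) by blast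
next
  fix c assume "c \<in> insert (i + 1, i) (map_prod (elem_refl i) (elem_refl i) ` down_pairs n p)"
  then consider "c = (i + 1, i)"
    | a b where "c = (elem_refl i a, elem_refl i b)" "(a, b) \<in> down_pairs n p" by auto
  then show "c \<in> down_pairs n (refl_vertex i p)"
  proof cases
    case 1
    then show ?thesis using assms
      by (auto simp: down_pairs_def mem_refl_vertex elem_refl_def)
  next
    case (2 a b)
    then have ab: "a \<in> p" "b \<in> {1..n}" "b \<notin> p" "b < a" by (auto simp: down_pairs_def)
    then have "elem_refl i b < elem_refl i a" using assms by (intro elem_refl_less) auto
    then show ?thesis
      using 2(1) ab elem_refl_mem[OF assms(1), of b] by (simp add: down_pairs_def mem_refl_vertex)
  qed
qed

text \<open>After reflection the pair \<open>(i + 1, i)\<close> contributes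
  \<open>coord (i + 1) - coord i\<close>, the source of the sign; the other factors become those at
  \<open>p\<close>.\<close>

lemma refl_poly_prod_down_pairs:
  assumes "i \<in> {1..n - 1}" "finite p" "i \<in> p" "i + 1 \<notin> p"
  shows "refl_poly i (\<Prod>(a, b)\<in>down_pairs n (refl_vertex i p). coord b - coord a)
    = - (coord i - coord (i + 1)) * (\<Prod>(a, b)\<in>down_pairs n p. coord b - coord a)"
proof -
  let ?m = "map_prod (elem_refl i) (elem_refl i)"
  have "(i, i + 1) \<notin> down_pairs n p" by (simp add: down_pairs_def)
  then have notin: "(i + 1, i) \<notin> ?m ` down_pairs n p"
    by (force simp: down_pairs_def elem_refl_def Transposition.transpose_def split: if_splits)
  have inj: "inj_on ?m (down_pairs n p)" by (auto simp: inj_on_def)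
  have "refl_poly i (\<Prod>(a, b)\<in>down_pairs n (refl_vertex i p). coord b - coord a)
    = (\<Prod>(a, b)\<in>down_pairs n (refl_vertex i p). coord (elem_refl i b) - coord (elem_refl i a))"
    by (simp add: refl_poly_hom refl_poly_coord case_prod_unfold)
  also have "\<dots> = (coord (i + 1) - coord i) * (\<Prod>(a, b)\<in>down_pairs n p. coord b - coord a)"
    unfolding down_pairs_refl_vertex[OF assms(1,3,4)]
    using notin finite_down_pairs[OF assms(2)]
    by (simp add: prod.reindex[OF inj] case_prod_unfold) (simp add: elem_refl_def)
  finally show ?thesis by simp
qed

lemma is_thom_class_div_diff:
  assumes k: "0 < k" and i: "i \<in> {1..n - 1}" and p: "p \<in> vertices n k" "i \<in> p" "i + 1 \<notin> p"
    and f: "is_thom_class n k (refl_vertex i p) f"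
  shows "is_thom_class n k p (div_diff n k i f)"
proof -
  let ?d = "coord i - coord (i + 1)" and ?q = "refl_vertex i p"
  have q: "?q \<in> vertices n k" using i p by (intro refl_vertex_in_vertices)
  have fin: "finite p" using vertices_subset[OF p(1)] finite_subset by blast
  have phi: "phi ?q = phi p + 1" using phi_refl_vertex_up[OF fin p(2,3)] .
  then have index: "index n k ?q = Suc (index n k p)"
    using phi_eq_index[OF k q] phi_eq_index[OF k p(1)] by simp
  have fc: "f \<in> cohom n k" and deg: "\<And>v. v \<in> vertices n k \<Longrightarrow> f v \<in> poly_ring_deg n (Suc (index n k p))"
    and supp: "\<And>v. v \<in> vertices n k \<Longrightarrow> f v \<noteq> 0 \<Longrightarrow> v \<in> flow_up n k ?q"
    and fq: "f ?q = (\<Prod>(a, b)\<in>down_pairs n ?q. coord b - coord a)"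
    using f prod_down_edges[OF k q] index by (auto simp: is_thom_class_def cohom_even_def)
  have spec: "?d * div_diff n k i f v = f v - refl_poly i (f (refl_vertex i v))" if "v \<in> vertices n k" for v
    using coord_diff_mult_div_diff[OF k i fc that] .
  \<comment> \<open>Dividing by a linear form lowers the degree by one, just as the index drops from
    \<open>?q\<close> to \<open>p\<close>.\<close>
  have "div_diff n k i f v \<in> poly_ring_deg n (index n k p)" if v: "v \<in> vertices n k" for v
  proof (rule poly_ring_deg_quot)
    show "?d * div_diff n k i f v \<in> poly_ring_deg n (Suc (index n k p))"
      unfolding spec[OF v] using v i
      by (intro poly_ring_deg_diff refl_poly_in_poly_ring_deg deg refl_vertex_in_vertices)
  qed (use i coord_diff_ne_0 coord_diff_in_poly_ring_deg in blast)+
  then have "div_diff n k i f \<in> cohom_even n k (index n k p)"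
    using div_diff_in_cohom[OF k i fc] by (simp add: cohom_even_def)
  moreover have "v \<in> flow_up n k p" if v: "v \<in> vertices n k" "div_diff n k i f v \<noteq> 0" for v
  proof -
    \<comment> \<open>A nonzero quotient needs a nonzero value of \<open>f\<close> at
      \<open>v\<close> or at its reflection; the lifting property covers either case.\<close>
    have "f v \<noteq> 0 \<or> f (refl_vertex i v) \<noteq> 0" using spec[OF v(1)] v(2) coord_diff_ne_0[of i] by auto
    then have "v \<in> flow_up n k ?q \<or> refl_vertex i v \<in> flow_up n k ?q"
      using supp v(1) refl_vertex_in_vertices[OF i] by blast
    then show ?thesis using flow_up_refl_vertex[OF k i p] by force
  qed
  moreover have "div_diff n k i f p = (\<Prod>e\<in>down_edges n k p. axial e)"
  proof -
    \<comment> \<open>As \<open>p\<close> is lower than \<open>?q\<close>, only the reflected term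
      of the numerator remains, and its sign cancels that of the reflected product.\<close>
    have "p \<notin> flow_up n k ?q" using flow_up_phi[of p n k ?q] phi by force
    then have "f p = 0" using supp p(1) by blast
    then have "?d * div_diff n k i f p = - refl_poly i (f ?q)" using spec[OF p(1)] by simp
    also have "\<dots> = ?d * (\<Prod>(a, b)\<in>down_pairs n p. coord b - coord a)"
      unfolding fq refl_poly_prod_down_pairs[OF i fin p(2,3)]
      by (simp only: mult_minus_left minus_minus)
    finally show ?thesis using coord_diff_ne_0[of i] by (simp add: prod_down_edges[OF k p(1)])
  qed
  ultimately show ?thesis by (simp add: is_thom_class_def)
qed

text \<open>\<open>fold\<close> moves the vertex by the letters from first to last, while
  \<open>foldr\<close> applies the operator of the last letter first. Peeling off the first letter
  thus removes the lowest ascent and the outermost operator together.\<close>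

lemma is_thom_class_foldr_div_diff:
  assumes "0 < k" "set w \<subseteq> {1..n - 1}" "p \<in> vertices n k"
    and "\<And>j. j < length w \<Longrightarrow>
      phi (fold refl_vertex (take j w) p) < phi (fold refl_vertex (take (Suc j) w) p)"
    and "is_thom_class n k (fold refl_vertex w p) f"
  shows "is_thom_class n k p (foldr (div_diff n k) w f)"
  using assms(2-)
proof (induction w arbitrary: p)
  case (Cons i w)
  have i: "i \<in> {1..n - 1}" using Cons.prems by simp
  have "finite p" using vertices_subset[OF Cons.prems(2)] finite_subset by blast
  then have p: "i \<in> p \<and> i + 1 \<notin> p"
    using Cons.prems(3)[of 0] by (intro phi_refl_vertex_lessD) simp_all
  have "is_thom_class n k (refl_vertex i p) (foldr (div_diff n k) w f)"
  proof (rule Cons.IH)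
    show "phi (fold refl_vertex (take j w) (refl_vertex i p))
        < phi (fold refl_vertex (take (Suc j) w) (refl_vertex i p))" if "j < length w" for j
      using Cons.prems(3)[of "Suc j"] that by simp
  qed (use Cons.prems i in \<open>simp_all add: refl_vertex_in_vertices\<close>)
  then show ?case using is_thom_class_div_diff[OF assms(1) i Cons.prems(2)] p by simp
qed simp

theorem mainTheorem9:
  fixes n k l r s :: nat and p p0 :: "nat set" and w :: "nat list"
  assumes "0 < k" and "k < n" and "l = n - k"
    and "p0 = {l + 1..n}"
    and "p \<in> vertices n k" and "index n k p = r"
    and "s = k * l - r" and "length w = s" and "set w \<subseteq> {1..n - 1}"
    and "p0 = fold refl_vertex w p"
    and "strict_mono_on {0..s} (\<lambda>j. phi (fold refl_vertex (take j w) p))"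
  shows "thom_class n k p = foldr (div_diff n k) w (thom_class n k p0)"
proof -
  have p0: "p0 \<in> vertices n k" using assms(1-4) by (auto simp: vertices_def)
  \<comment> \<open>Existence is established at the top vertex and carried down to \<open>p\<close>
    by the word; uniqueness then identifies \<open>thom_class\<close> at both ends.\<close>
  obtain f where f: "is_thom_class n k p0 f"
    using is_thom_class_top[OF assms(1,2)] assms(3,4) by blast
  then have "thom_class n k p0 = f" using thom_class_eqI[OF assms(1) p0] by blast
  moreover have "is_thom_class n k p (foldr (div_diff n k) w f)"
  proof (rule is_thom_class_foldr_div_diff[OF assms(1,9,5)])
    show "phi (fold refl_vertex (take j w) p) < phi (fold refl_vertex (take (Suc j) w) p)"
      if "j < length w" for j
      using strict_mono_onD[OF assms(11), of j "Suc j"] that assms(8) by simp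
  qed (use f assms(10) in simp)
  ultimately show ?thesis using thom_class_eqI[OF assms(1,5)] by simp
qed

end
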